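(* Let $\mathbb X$ be a separable infinite-dimensional Banach space over $\mathbb F=\mathbb R$ or $\mathbb C$, let $\mathbf n=(n_k)_{k\in\mathbb N}$ be a strictly increasing sequence of natural numbers and $0<t\le1$. Suppose that $\mathcal B=(\mathbf e_i)_{i\in\mathbb N}$ is a $\mathbf C_{q,t}$-$\mathbf n$-$t$-quasi-greedy (semi-normalized) Schauder basis of $\mathbb X$ with basis constant $\mathbf K$. Then for every $k\in\mathbb N$, every $l\in\mathbb N$ with $l>1$, every $x\in\mathbb X$ and every $t$-greedy set $A$ for $x$ with $n_k\le|A|<l\cdot n_k$, $$\|P_A(x)\|\le 2\,\mathbf C_{q,t}\,\mathbf K\,(l-1+\mathbf K)\,\|x\|.$$ In particular, if $\mathbf n$ has bounded gaps, then $\mathcal B$ is quasi-greedy.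
   Context: A semi-normalized Schauder basis of $\mathbb X$ is a sequence $(\mathbf e_i)_{i\in\mathbb N}\subset\mathbb X$ with dense linear span and biorthogonal functionals $(\mathbf e_i^* )_{i\in\mathbb N}\subset\mathbb X^*$ ($\mathbf e_k^*(\mathbf e_i)=\delta_{k,i}$), such that $\mathbf e_i^*(x)=0$ for all $i$ implies $x=0$, $\sup_i\{\|\mathbf e_i\|,\|\mathbf e_i^*\|\}<\infty$, and there is $C>0$ with $\|S_m(x)\|\le C\|x\|$ for all $x\in\mathbb X$, $m\in\mathbb N$, where $S_m(x)=\sum_{i=1}^m\mathbf e_i^*(x)\mathbf e_i$. The basis constant $\mathbf K$ is the minimum such $C$. For a finite set $A\subset\mathbb N$, $P_A(x)=\sum_{i\in A}\mathbf e_i^*(x)\mathbf e_i$. For $0<t\le1$, a finite set $A\subset\mathbb N$ is a $t$-greedy set for $x\in\mathbb X$ if $\min_{i\in A}|\mathbf e_i^*(x)|\ge t\max_{i\notin A}|\mathbf e_i^*(x)|$, i.e. $|\mathbf e_i^*(x)|\ge t|\mathbf e_j^*(x)|$ for all $i\in A$, $j\notin A$. If $t=1$, one says greedy set. $\mathcal B$ is $\mathbf C_{q,t}$-$\mathbf n$-$t$-quasi-greedy if $\mathbf C_{q,t}$ is the smallest constant $C$ such that $\|P_A(x)\|\le C\|x\|$ for all $x\in\mathbb X$ and all $t$-greedy sets $A$ for $x$ with $|A|\in\mathbf n$ (that is, $|A|=n_k$ for some $k$). $\mathcal B$ is quasi-greedy if there is $C>0$ such that $\|P_A(x)\|\le C\|x\|$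 for all $x\in\mathbb X$ and all (finite) greedy sets $A$ for $x$. $\mathbf n$ has bounded gaps if there is an integer $l>1$ with $n_{i+1}/n_i\le l$ for all $i\in\mathbb N$. *)

theory Defs
  imports "HOL-Analysis.Analysis"
begin

text \<open>
  A Banach space over \<open>\<real>\<close> or \<open>\<complex>\<close>. The norm, the topology and completeness come from the class
  \<^class>\<open>banach\<close>; \<open>smul\<close> is the multiplication by scalars of \<open>'k\<close> and extends the real one. By
  the Gelfand--Mazur theorem, a \<^class>\<open>real_normed_field\<close> is isometrically isomorphic to \<open>\<real>\<close> or
  \<open>\<complex>\<close>, so quantification over \<open>'k\<close> is the choice of the field \<open>\<real>\<close> or \<open>\<complex>\<close>.
\<close>

locale banach_space_over = vector_space smul
  for smul :: "'k::real_normed_field \<Rightarrow> 'a::banach \<Rightarrow> 'a" +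
  assumes norm_smul: "norm (smul c x) = norm c * norm x"
    and smul_of_real: "smul (of_real r) x = r *\<^sub>R x"

lemma banach_space_over_real:
  "banach_space_over (scaleR :: real \<Rightarrow> 'a::banach \<Rightarrow> 'a)"
  by unfold_locales (auto simp: algebra_simps)

lemma banach_space_over_complex:
  "banach_space_over ((*) :: complex \<Rightarrow> complex \<Rightarrow> complex)"
  by unfold_locales (auto simp: algebra_simps norm_mult scaleR_conv_of_real)

definition infinite_dimensional :: "('k::field \<Rightarrow> 'a::ab_group_add \<Rightarrow> 'a) \<Rightarrow> bool" where
  "infinite_dimensional smul \<longleftrightarrow> (\<nexists>B. finite B \<and> module.span smul B = UNIV)"

definition dual_space ::
  "('k::real_normed_field \<Rightarrow> 'a::banach \<Rightarrow> 'a) \<Rightarrow> ('a \<Rightarrow> 'k) set" where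
  "dual_space smul = {f. Vector_Spaces.linear smul (*) f \<and> bounded_linear f}"

text \<open>
  In the following definitions \<open>e i\<close> are the basis vectors and \<open>es i\<close> the biorthogonal functionals,
  indexed from \<open>0\<close>. The functionals are determined by the vectors, whose span is dense.
\<close>

definition proj ::
  "('k::real_normed_field \<Rightarrow> 'a::banach \<Rightarrow> 'a) \<Rightarrow> (nat \<Rightarrow> 'a) \<Rightarrow> (nat \<Rightarrow> 'a \<Rightarrow> 'k) \<Rightarrow> nat set \<Rightarrow> 'a \<Rightarrow> 'a" where
  "proj smul e es A x = (\<Sum>i\<in>A. smul (es i x) (e i))"

definition partial_sum ::
  "('k::real_normed_field \<Rightarrow> 'a::banach \<Rightarrow> 'a) \<Rightarrow> (nat \<Rightarrow> 'a) \<Rightarrow> (nat \<Rightarrow> 'a \<Rightarrow> 'k) \<Rightarrow> nat \<Rightarrow> 'a \<Rightarrow> 'a" where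
  "partial_sum smul e es m x = (\<Sum>i<m. smul (es i x) (e i))"

definition seminormalized_schauder_basis ::
  "('k::real_normed_field \<Rightarrow> 'a::banach \<Rightarrow> 'a) \<Rightarrow> (nat \<Rightarrow> 'a) \<Rightarrow> (nat \<Rightarrow> 'a \<Rightarrow> 'k) \<Rightarrow> bool" where
  "seminormalized_schauder_basis smul e es \<longleftrightarrow>
     closure (module.span smul (range e)) = UNIV \<and>
     (\<forall>i. es i \<in> dual_space smul) \<and>
     (\<forall>k i. es k (e i) = (if k = i then 1 else 0)) \<and>
     (\<forall>x. (\<forall>i. es i x = 0) \<longrightarrow> x = 0) \<and>
     (\<exists>M. \<forall>i. norm (e i) \<le> M \<and> onorm (es i) \<le> M) \<and>
     (\<exists>C>0. \<forall>x m. norm (partial_sum smul e es m x) \<le> C * norm x)"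

definition is_minimum :: "real \<Rightarrow> real set \<Rightarrow> bool" where
  "is_minimum c S \<longleftrightarrow> c \<in> S \<and> (\<forall>C\<in>S. c \<le> C)"

definition is_basis_constant ::
  "('k::real_normed_field \<Rightarrow> 'a::banach \<Rightarrow> 'a) \<Rightarrow> (nat \<Rightarrow> 'a) \<Rightarrow> (nat \<Rightarrow> 'a \<Rightarrow> 'k) \<Rightarrow> real \<Rightarrow> bool" where
  "is_basis_constant smul e es K \<longleftrightarrow>
     is_minimum K {C. C > 0 \<and> (\<forall>x m. norm (partial_sum smul e es m x) \<le> C * norm x)}"

definition t_greedy_set ::
  "(nat \<Rightarrow> 'a::banach \<Rightarrow> 'k::real_normed_field) \<Rightarrow> real \<Rightarrow> 'a \<Rightarrow> nat set \<Rightarrow> bool" where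
  "t_greedy_set es t x A \<longleftrightarrow>
     finite A \<and> (\<forall>i\<in>A. \<forall>j. j \<notin> A \<longrightarrow> norm (es i x) \<ge> t * norm (es j x))"

definition n_t_quasi_greedy ::
  "('k::real_normed_field \<Rightarrow> 'a::banach \<Rightarrow> 'a) \<Rightarrow> (nat \<Rightarrow> 'a) \<Rightarrow> (nat \<Rightarrow> 'a \<Rightarrow> 'k) \<Rightarrow>
     (nat \<Rightarrow> nat) \<Rightarrow> real \<Rightarrow> real \<Rightarrow> bool" where
  "n_t_quasi_greedy smul e es n t Cq \<longleftrightarrow>
     is_minimum Cq {C. \<forall>x A. t_greedy_set es t x A \<and> card A \<in> range n \<longrightarrow>
                          norm (proj smul e es A x) \<le> C * norm x}"

definition quasi_greedy ::
  "('k::real_normed_field \<Rightarrow> 'a::banach \<Rightarrow> 'a) \<Rightarrow> (nat \<Rightarrow> 'a) \<Rightarrow> (nat \<Rightarrow> 'a \<Rightarrow> 'k) \<Rightarrow> bool" where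
  "quasi_greedy smul e es \<longleftrightarrow>
     (\<exists>C>0. \<forall>x A. t_greedy_set es 1 x A \<longrightarrow> norm (proj smul e es A x) \<le> C * norm x)"

definition bounded_gaps :: "(nat \<Rightarrow> nat) \<Rightarrow> bool" where
  "bounded_gaps n \<longleftrightarrow> (\<exists>l::nat. l > 1 \<and> (\<forall>i. real (n (Suc i)) / real (n i) \<le> real l))"

end

theory Submission
  imports Defs
begin

text \<open>
  Write \<open>|A| = q n\<^sub>k + r\<close> with \<open>r < n\<^sub>k\<close> and cut \<open>A\<close>, from left to right, into a first piece of
  \<open>r\<close> elements followed by \<open>q \<le> l - 1\<close> blocks of \<open>n\<^sub>k\<close> elements. A block is the intersection of
  \<open>A\<close> with an interval \<open>I\<close>, hence it is a \<open>t\<close>-greedy set for the projection of \<open>x\<close> to \<open>I\<close>, whose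
  norm is at most \<open>2 K \<parallel>x\<parallel>\<close>. The first piece is an initial section of the first \<open>n\<^sub>k\<close> elements of \<open>A\<close>,
  and these form a \<open>t\<close>-greedy set for a partial sum of \<open>x\<close>; one more partial sum restricts their
  projection to the first piece, at the total cost \<open>C K\<^sup>2 \<parallel>x\<parallel>\<close>, where \<open>C\<close> is the greedy constant.
\<close>

section \<open>Initial sections of sets of naturals\<close>

lemma card_initial_section_surj:
  fixes A :: "nat set"
  assumes "c \<le> card (A \<inter> {..<m})"
  shows "\<exists>m'\<le>m. card (A \<inter> {..<m'}) = c"
  using assms
proof (induction m)
  case (Suc m)
  \<comment> \<open>Moving the cut by one adds at most one element, so no cardinality is skipped: a
    discrete intermediate value argument.\<close>
  have "A \<inter> {..<Suc m} \<subseteq> insert m (A \<inter> {..<m})"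
    by (auto simp: less_Suc_eq)
  then have "card (A \<inter> {..<Suc m}) \<le> Suc (card (A \<inter> {..<m}))"
    by (rule card_mono[of "insert m (A \<inter> {..<m})", THEN order_trans, rotated])
      (simp_all add: card_insert_if)
  with Suc show ?case
    by (cases "c \<le> card (A \<inter> {..<m})") (auto intro: le_SucI)
qed auto

lemma finite_nat_eq_initial_section:
  fixes A :: "nat set"
  assumes "finite A"
  obtains m where "A \<inter> {..<m} = A"
proof -
  obtain m where "\<forall>i\<in>A. i < m"
    using assms finite_nat_set_iff_bounded by blast
  then have "A \<inter> {..<m} = A"
    by auto
  then show ?thesis
    by (rule that)
qed

lemma t_greedy_set_mono:
  assumes "t_greedy_set es s x A" and "t \<le> s"
  shows "t_greedy_set es t x A"
  using assms unfolding t_greedy_set_def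
  by (meson mult_right_mono norm_ge_zero order_trans)

section \<open>Coordinate projections of a Schauder basis\<close>

locale schauder_basis = banach_space_over smul
  for smul :: "'k::real_normed_field \<Rightarrow> 'a::banach \<Rightarrow> 'a" +
  fixes e :: "nat \<Rightarrow> 'a" and es :: "nat \<Rightarrow> 'a \<Rightarrow> 'k"
  assumes basis: "seminormalized_schauder_basis smul e es"
begin

lemma bounded_linear_coord: "bounded_linear (es i)"
  and linear_coord: "Vector_Spaces.linear smul (*) (es i)"
  using basis by (auto simp: seminormalized_schauder_basis_def dual_space_def)

lemma coord_basis: "es k (e i) = (if k = i then 1 else 0)"
  using basis by (simp add: seminormalized_schauder_basis_def)

lemma coord_smul: "es i (smul c x) = c * es i x"
  using linear_coord by (rule module_hom.scale[OF Vector_Spaces.linear.axioms(3)])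

lemma basis_nonzero: "e i \<noteq> 0"
  using coord_basis[of i i] linear_simps(3)[OF bounded_linear_coord[of i]] by auto

lemma coord_proj:
  assumes "finite A"
  shows "es k (proj smul e es A x) = (if k \<in> A then es k x else 0)"
proof -
  have "es k (proj smul e es A x) = (\<Sum>i\<in>A. es k (smul (es i x) (e i)))"
    unfolding proj_def
    using bounded_linear.linear[OF bounded_linear_coord] by (rule Real_Vector_Spaces.linear_sum)
  also have "\<dots> = (\<Sum>i\<in>A. if k = i then es i x else 0)"
    by (intro sum.cong) (auto simp: coord_smul coord_basis)
  finally show ?thesis
    using assms by simp
qed

lemma proj_proj:
  assumes "finite A" "finite B"
  shows "proj smul e es A (proj smul e es B x) = proj smul e es (A \<inter> B) x"
proof -
  have "proj smul e es A (proj smul e es B x)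
      = (\<Sum>i\<in>A. if i \<in> B then smul (es i x) (e i) else 0)"
    unfolding proj_def[of smul e es A]
    using assms by (intro sum.cong) (auto simp: coord_proj)
  with assms show ?thesis
    by (simp add: proj_def sum.inter_restrict)
qed

lemma partial_sum_eq_proj: "partial_sum smul e es m x = proj smul e es {..<m} x"
  by (simp add: partial_sum_def proj_def)

lemma proj_Un_disjoint:
  assumes "finite A" "finite B" "A \<inter> B = {}"
  shows "proj smul e es (A \<union> B) x = proj smul e es A x + proj smul e es B x"
  using assms by (simp add: proj_def sum.union_disjoint)

text \<open>An index outside \<open>A \<inter> I\<close> either lies outside \<open>I\<close>, where
  the coordinate is now 0, or lies in \<open>I - A\<close>, where the original inequality applies
  unchanged.\<close>

lemma t_greedy_set_proj:
  assumes "t_greedy_set es t x A" and "finite I"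
  shows "t_greedy_set es t (proj smul e es I x) (A \<inter> I)"
  using assms by (auto simp: t_greedy_set_def coord_proj)

text \<open>This crude bound, free of greediness, serves the sets smaller than the first term of the
  sequence. It comes from estimating each summand by the common bound on vectors and functionals, so
  the witness is the square of that bound.\<close>

lemma norm_proj_le_card:
  obtains M where "M > 0" "\<And>A x. norm (proj smul e es A x) \<le> real (card A) * M * norm x"
proof -
  have "\<exists>M. \<forall>i. norm (e i) \<le> M \<and> onorm (es i) \<le> M"
    using basis by (simp add: seminormalized_schauder_basis_def)
  then obtain M where M: "norm (e i) \<le> M" "onorm (es i) \<le> M" for i
    by auto
  have "M > 0"
    using M(1)[of 0] basis_nonzero[of 0] by (simp add: less_le_trans[of 0 "norm (e 0)"])
  have "norm (proj smul e es A x) \<le> real (card A) * (M * M) * norm x" for A x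
  proof -
    have "norm (proj smul e es A x) \<le> (\<Sum>i\<in>A. norm (es i x) * norm (e i))"
      unfolding proj_def by (rule sum_norm_le) (simp add: norm_smul)
    also have "\<dots> \<le> (\<Sum>i\<in>A. (M * norm x) * M)"
    proof (intro sum_mono mult_mono)
      fix i
      have "norm (es i x) \<le> onorm (es i) * norm x"
        by (rule onorm[OF bounded_linear_coord])
      also have "\<dots> \<le> M * norm x"
        using M by (intro mult_right_mono) auto
      finally show "norm (es i x) \<le> M * norm x" .
    qed (use M \<open>M > 0\<close> in auto)
    finally show ?thesis
      by (simp add: mult_ac)
  qed
  with \<open>M > 0\<close> that[of "M * M"] show ?thesis
    by simp
qed

section \<open>Bounds for projections to greedy sets\<close>

lemma greedy_bound_nonneg:
  assumes "\<And>x A. t_greedy_set es t x A \<Longrightarrow> card A = N \<Longrightarrow> norm (proj smul e es A x) \<le> C * norm x"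
    and "N \<ge> 1"
  shows "0 \<le> C"
proof -
  \<comment> \<open>As \<open>0 < N\<close>, the only nonzero coordinate of \<open>e 0\<close> lies
    inside \<open>{..<N}\<close>.\<close>
  have "t_greedy_set es t (e 0) {..<N}"
    using assms(2) by (auto simp: t_greedy_set_def coord_basis)
  then have "0 \<le> C * norm (e 0)"
    using assms(1)[of "e 0" "{..<N}"] by (simp add: order_trans[OF norm_ge_zero])
  then show ?thesis
    using basis_nonzero[of 0] by (simp add: zero_le_mult_iff)
qed

text \<open>The induction removes the rightmost block. Sections of one fixed \<open>A\<close> are
  used because they need not be greedy for \<open>x\<close> themselves; only \<open>A\<close> has to
  be.\<close>

lemma norm_proj_initial_section_le:
  assumes K: "\<And>x m. norm (partial_sum smul e es m x) \<le> K * norm x" "K > 0"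
    and C: "\<And>x A. t_greedy_set es t x A \<Longrightarrow> card A = N \<Longrightarrow> norm (proj smul e es A x) \<le> C * norm x"
    and "C \<ge> 0" and A: "t_greedy_set es t x A" "N \<le> card A" and "r < N"
  shows "card (A \<inter> {..<m}) = q * N + r \<Longrightarrow>
    norm (proj smul e es (A \<inter> {..<m}) x) \<le> (2 * C * K * real q + C * K\<^sup>2) * norm x"
proof (induction q arbitrary: m)
  case 0
  obtain b where b: "A \<inter> {..<b} = A"
    using A(1) finite_nat_eq_initial_section unfolding t_greedy_set_def by blast
  then obtain m' where m': "card (A \<inter> {..<m'}) = N"
    using card_initial_section_surj[of N A b] A(2) by auto
  \<comment> \<open>The cut at \<open>m\<close> keeps only \<open>r < N\<close> elements, so it lies
    to the left of the cut that keeps \<open>N\<close>.\<close>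
  have "m \<le> m'"
  proof (rule ccontr)
    assume "\<not> m \<le> m'"
    then have "card (A \<inter> {..<m'}) \<le> card (A \<inter> {..<m})"
      by (intro card_mono) auto
    with m' 0 \<open>r < N\<close> show False
      by simp
  qed
  let ?y = "proj smul e es {..<m'} x"
  have "proj smul e es (A \<inter> {..<m}) x = partial_sum smul e es m (proj smul e es (A \<inter> {..<m'}) ?y)"
    using \<open>m \<le> m'\<close> unfolding partial_sum_eq_proj
    by (simp add: proj_proj Int_assoc) (rule arg_cong[where f = "\<lambda>S. proj smul e es S x"], auto)
  also have "norm \<dots> \<le> K * norm (proj smul e es (A \<inter> {..<m'}) ?y)"
    by (rule K)
  also have "\<dots> \<le> K * (C * norm ?y)"
    using C[OF t_greedy_set_proj[OF A(1)] m'] K(2) by (intro mult_left_mono) auto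
  also have "\<dots> \<le> K * (C * (K * norm x))"
    using K(1)[of m' x] K(2) \<open>C \<ge> 0\<close> by (intro mult_left_mono) (auto simp: partial_sum_eq_proj)
  finally show ?case
    by (simp add: power2_eq_square mult_ac)
next
  case (Suc q)
  obtain m' where m': "m' \<le> m" "card (A \<inter> {..<m'}) = q * N + r"
    using card_initial_section_surj[of "q * N + r" A m] Suc.prems by auto
  have split: "A \<inter> {..<m} = (A \<inter> {..<m'}) \<union> (A \<inter> {m'..<m})" "{..<m} = {..<m'} \<union> {m'..<m}"
    using m'(1) by auto
  have "card (A \<inter> {..<m}) = card (A \<inter> {..<m'}) + card (A \<inter> {m'..<m})"
    unfolding split(1) by (rule card_Un_disjoint) auto
  then have block: "card (A \<inter> {m'..<m}) = N"
    using Suc.prems m'(2) by simp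
  let ?y = "proj smul e es {m'..<m} x"
  \<comment> \<open>Projecting to an interval takes two partial sums, whence the factor
    \<open>2 * K\<close> of each block.\<close>
  have "?y = partial_sum smul e es m x - partial_sum smul e es m' x"
    unfolding partial_sum_eq_proj split(2) by (subst proj_Un_disjoint) auto
  then have "norm ?y \<le> K * norm x + K * norm x"
    using norm_triangle_le_diff add_mono[OF K(1) K(1)] by metis
  then have y: "C * norm ?y \<le> C * (2 * K * norm x)"
    using \<open>C \<ge> 0\<close> by (intro mult_left_mono) auto
  have "proj smul e es (A \<inter> {m'..<m}) x = proj smul e es (A \<inter> {m'..<m}) ?y"
    by (simp add: proj_proj Int_assoc)
  then have "norm (proj smul e es (A \<inter> {m'..<m}) x) \<le> 2 * C * K * norm x"
    using C[OF t_greedy_set_proj[OF A(1)] block] y by simp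
  moreover have "norm (proj smul e es (A \<inter> {..<m}) x)
      \<le> norm (proj smul e es (A \<inter> {..<m'}) x) + norm (proj smul e es (A \<inter> {m'..<m}) x)"
    unfolding split(1) by (subst proj_Un_disjoint) (auto intro: norm_triangle_ineq)
  ultimately show ?case
    using Suc.IH[OF m'(2)] by (simp add: algebra_simps)
qed

lemma norm_proj_greedy_le:
  assumes K: "\<And>x m. norm (partial_sum smul e es m x) \<le> K * norm x" "K > 0"
    and C: "\<And>x A. t_greedy_set es t x A \<Longrightarrow> card A = N \<Longrightarrow> norm (proj smul e es A x) \<le> C * norm x"
    and A: "t_greedy_set es t x A" "N \<le> card A" "card A < l * N"
  shows "norm (proj smul e es A x) \<le> 2 * C * K * (real l - 1 + K) * norm x"
proof -
  have "N \<ge> 1"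
    using A(3) by (cases N) auto
  then have "C \<ge> 0"
    using C greedy_bound_nonneg by blast
  have q: "card A div N < l" "card A mod N < N"
    using A(3) \<open>N \<ge> 1\<close> by (auto simp: less_mult_imp_div_less)
  obtain b where b: "A \<inter> {..<b} = A"
    using A(1) finite_nat_eq_initial_section unfolding t_greedy_set_def by blast
  have "norm (proj smul e es A x) \<le> (2 * C * K * real (card A div N) + C * K\<^sup>2) * norm x"
    using norm_proj_initial_section_le[OF K C \<open>C \<ge> 0\<close> A(1,2) q(2), of b "card A div N"] b
    by simp
  \<comment> \<open>The integer quotient is below \<open>l\<close>, hence at most
    \<open>l - 1\<close>. Doubling the term \<open>C * K\<^sup>2\<close> lets
    \<open>2 * C * K\<close> be factored out.\<close>
  also have "\<dots> \<le> (2 * C * K * (real l - 1) + 2 * C * K * K) * norm x"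
    using q(1) K(2) \<open>C \<ge> 0\<close>
    by (intro mult_right_mono add_mono mult_left_mono) (auto simp: power2_eq_square)
  finally show ?thesis
    by (simp add: algebra_simps)
qed

end

theorem theorem5p2:
  fixes smul :: "'k::real_normed_field \<Rightarrow> 'a::banach \<Rightarrow> 'a"
    and e :: "nat \<Rightarrow> 'a" and es :: "nat \<Rightarrow> 'a \<Rightarrow> 'k"
    and n :: "nat \<Rightarrow> nat" and t Cq K :: real
  assumes "banach_space_over smul"
    and "separable_space (euclidean :: 'a topology)"
    and "infinite_dimensional smul"
    and "strict_mono n" and "\<forall>k. n k \<ge> 1"
    and "0 < t" and "t \<le> 1"
    and "seminormalized_schauder_basis smul e es"
    and "is_basis_constant smul e es K"
    and "n_t_quasi_greedy smul e es n t Cq"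
  shows "(\<forall>(k::nat) (l::nat) (x::'a) A.
            l > 1 \<and> t_greedy_set es t x A \<and> n k \<le> card A \<and> card A < l * n k \<longrightarrow>
            norm (proj smul e es A x) \<le> 2 * Cq * K * (real l - 1 + K) * norm x)
       \<and> (bounded_gaps n \<longrightarrow> quasi_greedy smul e es)"
proof -
  interpret schauder_basis smul e es
    using assms(1,8) by (simp add: schauder_basis_def schauder_basis_axioms_def)
  have K: "norm (partial_sum smul e es m x) \<le> K * norm x" "K > 0" for m x
    using assms(9) by (auto simp: is_basis_constant_def is_minimum_def)
  have C: "norm (proj smul e es A x) \<le> Cq * norm x"
    if "t_greedy_set es t x A" "card A = n k" for x A k
    using assms(10) that by (auto simp: n_t_quasi_greedy_def is_minimum_def)
  have bound: "norm (proj smul e es A x) \<le> 2 * Cq * K * (real l - 1 + K) * norm x"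
    if "t_greedy_set es t x A" "n k \<le> card A" "card A < l * n k" for x A k l
    using norm_proj_greedy_le[OF K C that] .
  have "quasi_greedy smul e es" if gaps: "bounded_gaps n"
  proof -
    obtain l where l: "real (n (Suc i)) / real (n i) \<le> real l" for i
      using gaps by (auto simp: bounded_gaps_def)
    \<comment> \<open>Since \<open>n i\<close> is positive, the quotient is a genuine one and not
      the default value 0 of division by zero.\<close>
    have gap: "n (Suc i) \<le> l * n i" for i
    proof -
      have "real (n (Suc i)) \<le> real (l * n i)"
        using l[of i] assms(5)[rule_format, of i] by (simp add: divide_le_eq)
      then show ?thesis
        by (simp only: of_nat_le_iff)
    qed
    obtain M where M: "M > 0" "\<And>A x. norm (proj smul e es A x) \<le> real (card A) * M * norm x"
      by (rule norm_proj_le_card) blast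
    \<comment> \<open>The final constant adds \<open>\<bar>D\<bar>\<close> and the crude bound for
      cardinalities below \<open>n 0\<close>, so that it dominates both cases.\<close>
    define D where "D = 2 * Cq * K * (real l - 1 + K)"
    have "norm (proj smul e es A x) \<le> (\<bar>D\<bar> + real (n 0) * M) * norm x"
      if A: "t_greedy_set es 1 x A" for x A
    proof (cases "card A < n 0")
      case True
      have "norm (proj smul e es A x) \<le> real (card A) * M * norm x"
        by (rule M)
      also have "\<dots> \<le> (\<bar>D\<bar> + real (n 0) * M) * norm x"
        using True M(1) by (intro mult_right_mono add_increasing) auto
      finally show ?thesis .
    next
      case False
      have "card A < n (Suc (card A))"
        using strict_mono_imp_increasing[OF assms(4), of "Suc (card A)"] by simp
      \<comment> \<open>The first term above \<open>card A\<close> is not \<open>n 0\<close>, so it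
        has a predecessor \<open>n k\<close>. Minimality gives \<open>n k \<le> card A\<close>, and
        the gap condition gives \<open>card A < l * n k\<close>.\<close>
      define j where "j = (LEAST j. card A < n j)"
      have j: "card A < n j"
        unfolding j_def by (rule LeastI) fact
      with False obtain k where k: "j = Suc k"
        by (cases j) auto
      then have "n k \<le> card A"
        using not_less_Least[of k "\<lambda>j. card A < n j"] j_def by simp
      moreover have "card A < l * n k"
        using j gap[of k] k by simp
      ultimately have "norm (proj smul e es A x) \<le> D * norm x"
        \<comment> \<open>A greedy set is \<open>t\<close>-greedy because
          \<open>t \<le> 1\<close>.\<close>
        unfolding D_def using bound t_greedy_set_mono[OF A assms(7)] by blast
      also have "\<dots> \<le> (\<bar>D\<bar> + real (n 0) * M) * norm x"
        using M(1) by (intro mult_right_mono add_increasing2) auto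
      finally show ?thesis .
    qed
    moreover have "\<bar>D\<bar> + real (n 0) * M > 0"
      using M(1) assms(5)[rule_format, of 0] by (simp add: add_nonneg_pos)
    ultimately show ?thesis
      unfolding quasi_greedy_def by blast
  qed
  with bound show ?thesis
    by blast
qed

end
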